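(* Let $n\ge0$ be an integer and let $\mathcal P\subset[0,1)^2$ be a $(0,n+1,2)$-net in base $2$ in which all points have coordinates of the form $k2^{-(n+1)}$ with $k\in\{0,1,\dots,2^{n+1}-1\}$. Then there exists a choice of coefficients $\varepsilon_R\in\{-1,+1\}$, for $R\in\mathcal D^2$ with $|R|=2^{-n}$, such that the sum $\sum_{R\in\mathcal D^2:\,|R|=2^{-n}}\varepsilon_R h_R(x)$ achieves its maximal value of $n+1$ on the set $$\mathcal P+\big[0,2^{-(n+1)}\big)^2,$$ i.e. on a set which consists of $2^{n+1}$ dyadic squares of side length $2^{-(n+1)}$ whose lower left corners are precisely the points of $\mathcal P$.
   Context: $\mathcal D$ denotes the set of dyadic intervals in $[0,1)$, i.e. intervals $[m2^{-k},(m+1)2^{-k})$ with $k\in\mathbb N_0=\{0,1,2,\dots\}$ and $m\in\{0,1,\dots,2^k-1\}$. For $I\in\mathcal D$, the ($L^\infty$-normalized) Haar function is $h_I=-\mathbf 1_{I_{left}}+\mathbf 1_{I_{right}}$, where $I_{left},I_{right}$ are the left and right (half-open) halves of $I$; so $h_I=0$ outside $I$. $\mathcal D^2$ is the set of dyadic rectangles (boxes) $R=R_1\times R_2$ with $R_1,R_2\in\mathcal D$, $|R|=|R_1|\,|R_2|$ is the area, and $h_R(x_1,x_2)=h_{R_1}(x_1)h_{R_2}(x_2)$. The set $A+B$ is the Minkowski sum $\{a+b: a\in A,\ b\in B\}$. For an integer $m\ge 0$, a $(0,m,2)$-net in base $2$ is a set $\mathcal P\subset[0,1)^2$ of $2^m$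 points such that every dyadic box of area $2^{-m}$ contains exactly one point of $\mathcal P$. *)

theory Defs
  imports "HOL-Analysis.Analysis"
begin

definition dyadic_intervals :: "real set set" where
  "dyadic_intervals =
     {{real m / 2 ^ k ..< (real m + 1) / 2 ^ k} | k m :: nat. m < 2 ^ k}"

text \<open>
  The two halves are only meaningful for an interval that is bounded and half-open on the right;
  \<^term>\<open>Inf\<close> and \<^term>\<open>Sup\<close> are then its endpoints.
\<close>

definition left_half :: "real set \<Rightarrow> real set" where
  "left_half I = {Inf I ..< (Inf I + Sup I) / 2}"

definition right_half :: "real set \<Rightarrow> real set" where
  "right_half I = {(Inf I + Sup I) / 2 ..< Sup I}"

definition haar :: "real set \<Rightarrow> real \<Rightarrow> real" where
  "haar I x = - indicator (left_half I) x + indicator (right_half I) x"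

text \<open>
  A dyadic rectangle is represented by its pair of sides \<open>(R\<^sub>1, R\<^sub>2)\<close>; as a set of points it is
  \<open>R\<^sub>1 \<times> R\<^sub>2\<close>.  All sides are nonempty, so the two descriptions determine each other.
\<close>

definition dyadic_boxes :: "(real set \<times> real set) set" where
  "dyadic_boxes = dyadic_intervals \<times> dyadic_intervals"

definition box_area :: "real set \<times> real set \<Rightarrow> real" where
  "box_area R = measure lborel (fst R) * measure lborel (snd R)"

definition box_points :: "real set \<times> real set \<Rightarrow> (real \<times> real) set" where
  "box_points R = fst R \<times> snd R"

definition haar2 :: "real set \<times> real set \<Rightarrow> real \<times> real \<Rightarrow> real" where
  "haar2 R x = haar (fst R) (fst x) * haar (snd R) (snd x)"

text \<open>A \<open>(0,m,2)\<close>-net in base 2.\<close>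

definition binary_net :: "nat \<Rightarrow> (real \<times> real) set \<Rightarrow> bool" where
  "binary_net m P \<longleftrightarrow>
     P \<subseteq> {0..<1} \<times> {0..<1} \<and> card P = 2 ^ m \<and>
     (\<forall>R\<in>dyadic_boxes. box_area R = 1 / 2 ^ m \<longrightarrow> (\<exists>!p. p \<in> P \<and> p \<in> box_points R))"

definition haar_sum ::
    "nat \<Rightarrow> (real set \<times> real set \<Rightarrow> real) \<Rightarrow> real \<times> real \<Rightarrow> real" where
  "haar_sum n \<epsilon> x = (\<Sum>R | R \<in> dyadic_boxes \<and> box_area R = 1 / 2 ^ n. \<epsilon> R * haar2 R x)"

definition dyadic_squares :: "nat \<Rightarrow> (real \<times> real) set set" where
  "dyadic_squares k =
     {box_points (I, J) | I J. I \<in> dyadic_intervals \<and> J \<in> dyadic_intervals \<and>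
        measure lborel I = 1 / 2 ^ k \<and> measure lborel J = 1 / 2 ^ k}"

end

theory Submission
  imports Defs
begin

text \<open>
  For \<open>x \<in> [0,1)\<^sup>2\<close> exactly one box \<open>R\<^sub>k\<close> of area \<open>2\<^sup>-\<^sup>n\<close> and width \<open>2\<^sup>-\<^sup>k\<close> contains \<open>x\<close>, for
  \<open>k = 0, \<dots>, n\<close>, so the sum has at most \<open>n + 1\<close> nonzero terms, each \<open>\<plusminus>1\<close>.  A half of a box \<open>R\<close> of area
  \<open>2\<^sup>-\<^sup>n\<close>, cut in either direction, has area \<open>2\<^sup>-\<^sup>(\<^sup>n\<^sup>+\<^sup>1\<^sup>)\<close> and contains a single net point; hence the two net
  points in \<open>R\<close> lie in diagonally opposite quarters, on which \<open>h\<^sub>R\<close> has the same sign.  Take that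
  sign as \<open>\<epsilon>\<^sub>R\<close>.  The sum is then \<open>n + 1\<close> on the squares attached to the net points.  Conversely,
  if all terms at \<open>x\<close> are \<open>1\<close>, let \<open>p\<close> be the net point in the box of width \<open>2\<^sup>-\<^sup>k\<close> and area
  \<open>2\<^sup>-\<^sup>(\<^sup>n\<^sup>+\<^sup>1\<^sup>)\<close> around \<open>x\<close>.  It lies in the same half of \<open>R\<^sub>k\<close> as \<open>x\<close> in the second coordinate, and
  the Haar function of \<open>R\<^sub>k\<close> has the same sign at both, so also in the first coordinate, i.e. in the box of width \<open>2\<^sup>-\<^sup>(\<^sup>k\<^sup>+\<^sup>1\<^sup>)\<close>.  Letting \<open>k\<close> run from
  \<open>0\<close> to \<open>n\<close> shows that \<open>p\<close> lies in the square of side \<open>2\<^sup>-\<^sup>(\<^sup>n\<^sup>+\<^sup>1\<^sup>)\<close> around \<open>x\<close>.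
\<close>

section \<open>Dyadic intervals addressed by a point they contain\<close>

definition dyadic_cell :: "nat \<Rightarrow> real \<Rightarrow> real set" where
  "dyadic_cell k t = {of_int \<lfloor>2 ^ k * t\<rfloor> / 2 ^ k ..< (of_int \<lfloor>2 ^ k * t\<rfloor> + 1) / 2 ^ k}"

lemma mem_dyadic_cell_iff: "u \<in> dyadic_cell k t \<longleftrightarrow> \<lfloor>2 ^ k * u\<rfloor> = \<lfloor>2 ^ k * t\<rfloor>"
  unfolding dyadic_cell_def floor_eq_iff by (auto simp: field_simps)

lemma mem_dyadic_cell_self [simp]: "t \<in> dyadic_cell k t"
  by (simp add: mem_dyadic_cell_iff)

lemma dyadic_cell_eq: "u \<in> dyadic_cell k t \<Longrightarrow> dyadic_cell k u = dyadic_cell k t"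
  unfolding mem_dyadic_cell_iff by (simp add: dyadic_cell_def)

lemma floor_double: "\<lfloor>2 ^ Suc k * (t :: real)\<rfloor> div 2 = \<lfloor>2 ^ k * t\<rfloor>"
  using floor_divide_real_eq_div[of 2 "2 ^ Suc k * t"] by simp

text \<open>The parity of \<open>\<lfloor>2 ^ Suc k * u\<rfloor>\<close> is the binary digit of
  \<open>u\<close> that selects a half of its level-\<open>k\<close> cell.\<close>

lemma dyadic_cell_Suc:
  "u \<in> dyadic_cell (Suc k) t \<longleftrightarrow>
     u \<in> dyadic_cell k t \<and> even \<lfloor>2 ^ Suc k * u\<rfloor> = even \<lfloor>2 ^ Suc k * t\<rfloor>"
proof -
  have "a = b \<longleftrightarrow> a div 2 = b div 2 \<and> even a = even b" for a b :: int
    by presburger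
  then show ?thesis
    unfolding mem_dyadic_cell_iff using floor_double[of k u] floor_double[of k t] by metis
qed

lemma dyadic_cell_antimono:
  assumes "k \<le> l" "u \<in> dyadic_cell l t"
  shows "u \<in> dyadic_cell k t"
  using assms by (induction l rule: dec_induct) (auto simp: dyadic_cell_Suc)

lemma measure_dyadic_cell [simp]: "measure lborel (dyadic_cell k t) = 1 / 2 ^ k"
  by (simp add: dyadic_cell_def field_simps)

lemma dyadic_cell_in_dyadic_intervals:
  assumes "t \<in> {0..<1}"
  shows "dyadic_cell k t \<in> dyadic_intervals"
proof -
  define m where "m = nat \<lfloor>2 ^ k * t\<rfloor>"
  have m: "real_of_int \<lfloor>2 ^ k * t\<rfloor> = real m"
    using assms by (simp add: m_def)
  have "real m \<le> 2 ^ k * t"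
    unfolding m[symmetric] by (rule of_int_floor_le)
  also have "\<dots> < real (2 ^ k)"
    using assms by simp
  finally have "m < 2 ^ k"
    unfolding of_nat_less_iff .
  then show ?thesis
    unfolding dyadic_cell_def dyadic_intervals_def m by blast
qed

lemma dyadic_intervals_eq_cell:
  assumes "I \<in> dyadic_intervals" "t \<in> I"
  shows "t \<in> {0..<1} \<and> (\<exists>k. I = dyadic_cell k t)"
proof -
  obtain k m :: nat where I: "I = {real m / 2 ^ k ..< (real m + 1) / 2 ^ k}" and m: "m < 2 ^ k"
    using assms(1) unfolding dyadic_intervals_def by blast
  have "\<lfloor>2 ^ k * t\<rfloor> = int m"
    using assms(2) unfolding I floor_eq_iff by (auto simp: field_simps)
  then have "I = dyadic_cell k t"
    unfolding I dyadic_cell_def by simp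
  moreover have "real m + 1 \<le> 2 ^ k"
    using m by (metis Suc_leI of_nat_Suc of_nat_le_iff of_nat_numeral of_nat_power add.commute)
  then have "(real m + 1) / 2 ^ k \<le> 1" by simp
  moreover have "0 \<le> real m / 2 ^ k" by simp
  ultimately show ?thesis
    using assms(2) unfolding I by (metis atLeastLessThan_iff order.strict_trans2 order.trans)
qed

lemma dyadic_intervals_nonempty: "I \<in> dyadic_intervals \<Longrightarrow> I \<noteq> {}"
  by (auto simp: dyadic_intervals_def divide_strict_right_mono)

text \<open>The halves are where the floor at level \<open>Suc k\<close> is \<open>2 * m\<close> or
  \<open>2 * m + 1\<close>, so the sign is read off a parity.\<close>

lemma haar_dyadic_cell:
  "haar (dyadic_cell k t) u =
     (if u \<in> dyadic_cell k t then if even \<lfloor>2 ^ Suc k * u\<rfloor> then - 1 else 1 else 0)"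
proof -
  define m where "m = \<lfloor>2 ^ k * t\<rfloor>"
  have lt: "real_of_int m / 2 ^ k < (of_int m + 1) / 2 ^ k"
    by (simp add: divide_strict_right_mono)
  have Inf: "Inf (dyadic_cell k t) = of_int m / 2 ^ k"
    and Sup: "Sup (dyadic_cell k t) = (of_int m + 1) / 2 ^ k"
    using lt by (simp_all add: dyadic_cell_def m_def)
  have mid: "(of_int m / 2 ^ k + (of_int m + 1) / 2 ^ k) / 2 = (2 * of_int m + 1) / (2 ^ Suc k :: real)"
    by (simp add: field_simps)
  have L: "u \<in> left_half (dyadic_cell k t) \<longleftrightarrow> \<lfloor>2 ^ Suc k * u\<rfloor> = 2 * m"
    unfolding left_half_def Inf Sup mid floor_eq_iff by (auto simp: field_simps)
  have R: "u \<in> right_half (dyadic_cell k t) \<longleftrightarrow> \<lfloor>2 ^ Suc k * u\<rfloor> = 2 * m + 1"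
    unfolding right_half_def Inf Sup mid floor_eq_iff by (auto simp: field_simps)
  have mem: "u \<in> dyadic_cell k t \<longleftrightarrow> \<lfloor>2 ^ Suc k * u\<rfloor> div 2 = m"
    unfolding floor_double by (simp add: mem_dyadic_cell_iff m_def)
  have "a div 2 = m \<longleftrightarrow> a = 2 * m \<or> a = 2 * m + 1" "even (2 * m)" "odd (2 * m + 1)" for a
    by presburger+
  then show ?thesis
    unfolding haar_def indicator_def L R mem by auto
qed

text \<open>Needed because \<open>sum\<close> over an infinite set is 0. The area forces the levels
  of the two sides to add up to \<open>n\<close>, which bounds both.\<close>

lemma finite_dyadic_boxes_area: "finite {R \<in> dyadic_boxes. box_area R = 1 / 2 ^ n}"
proof -
  define D :: "real set set" where
    "D = (\<Union>k\<le>n. (\<lambda>m. {real m / 2 ^ k ..< (real m + 1) / 2 ^ k}) ` {..<2 ^ k})"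
  have "R \<in> D \<times> D" if R: "R \<in> dyadic_boxes" and area: "box_area R = 1 / 2 ^ n" for R
  proof -
    obtain k m l q :: nat where
      R_eq: "R = ({real m / 2 ^ k ..< (real m + 1) / 2 ^ k}, {real q / 2 ^ l ..< (real q + 1) / 2 ^ l})"
      and mq: "m < 2 ^ k" "q < 2 ^ l"
      using R unfolding dyadic_boxes_def dyadic_intervals_def by blast
    have measure: "measure lborel {real i / 2 ^ h ..< (real i + 1) / 2 ^ h} = 1 / 2 ^ h" for i h
      by (simp add: divide_right_mono diff_divide_distrib[symmetric])
    have "box_area R = 1 / 2 ^ (k + l)"
      unfolding R_eq box_area_def fst_conv snd_conv measure by (simp add: power_add)
    then have "(2 :: real) ^ n = 2 ^ (k + l)"
      using area by simp
    then have "k \<le> n" "l \<le> n" by simp_all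
    then show ?thesis
      using mq unfolding R_eq D_def by blast
  qed
  then have "{R \<in> dyadic_boxes. box_area R = 1 / 2 ^ n} \<subseteq> D \<times> D"
    by blast
  moreover have "finite (D \<times> D)"
    by (simp add: D_def)
  ultimately show ?thesis
    by (rule finite_subset)
qed

section \<open>Dyadic boxes addressed by a point they contain\<close>

definition box_at :: "nat \<Rightarrow> nat \<Rightarrow> real \<times> real \<Rightarrow> real set \<times> real set" where
  "box_at k l x = (dyadic_cell k (fst x), dyadic_cell l (snd x))"

lemma mem_box_at_iff:
  "y \<in> box_points (box_at k l x) \<longleftrightarrow> fst y \<in> dyadic_cell k (fst x) \<and> snd y \<in> dyadic_cell l (snd x)"
  by (cases y) (simp add: box_points_def box_at_def)

lemma mem_box_at_self [simp]: "x \<in> box_points (box_at k l x)"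
  by (simp add: mem_box_at_iff)

lemma box_at_eq: "y \<in> box_points (box_at k l x) \<Longrightarrow> box_at k l y = box_at k l x"
  unfolding mem_box_at_iff by (simp add: box_at_def dyadic_cell_eq)

lemma box_area_box_at [simp]: "box_area (box_at k l x) = 1 / 2 ^ (k + l)"
  by (simp add: box_area_def box_at_def power_add)

lemma box_at_in_dyadic_boxes:
  "x \<in> {0..<1} \<times> {0..<1} \<Longrightarrow> box_at k l x \<in> dyadic_boxes"
  by (auto simp: dyadic_boxes_def box_at_def intro!: dyadic_cell_in_dyadic_intervals)

lemma dyadic_box_nonempty:
  assumes "R \<in> dyadic_boxes"
  shows "box_points R \<noteq> {}"
proof -
  have "fst R \<in> dyadic_intervals" "snd R \<in> dyadic_intervals"
    using assms by (auto simp: dyadic_boxes_def)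
  then show ?thesis
    using dyadic_intervals_nonempty by (simp add: box_points_def)
qed

lemma dyadic_box_eq_some_box_at:
  assumes "R \<in> dyadic_boxes" "x \<in> box_points R"
  shows "x \<in> {0..<1} \<times> {0..<1} \<and> (\<exists>k l. R = box_at k l x)"
proof -
  have mem: "fst R \<in> dyadic_intervals" "snd R \<in> dyadic_intervals" "fst x \<in> fst R" "snd x \<in> snd R"
    using assms by (auto simp: dyadic_boxes_def box_points_def)
  obtain k where "fst R = dyadic_cell k (fst x)" and x1: "fst x \<in> {0..<1}"
    using dyadic_intervals_eq_cell[OF mem(1,3)] by blast
  moreover obtain l where "snd R = dyadic_cell l (snd x)" and x2: "snd x \<in> {0..<1}"
    using dyadic_intervals_eq_cell[OF mem(2,4)] by blast
  ultimately have "R = box_at k l x"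
    by (simp add: box_at_def prod_eq_iff)
  with x1 x2 show ?thesis
    unfolding mem_Times_iff by blast
qed

lemma dyadic_box_eq_box_at:
  assumes "R \<in> dyadic_boxes" "box_area R = 1 / 2 ^ n" "x \<in> box_points R"
  shows "x \<in> {0..<1} \<times> {0..<1} \<and> (\<exists>k\<le>n. R = box_at k (n - k) x)"
proof -
  obtain k l where R: "R = box_at k l x" and x: "x \<in> {0..<1} \<times> {0..<1}"
    using dyadic_box_eq_some_box_at[OF assms(1,3)] by blast
  then have "(2 :: real) ^ n = 2 ^ (k + l)"
    using assms(2) by simp
  then have "n = k + l" by simp
  then have "k \<le> n" "R = box_at k (n - k) x"
    using R by simp_all
  with x show ?thesis by blast
qed

text \<open>Equal digits mean the lower left or upper right quarter, where the two factors have the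
  same sign.\<close>

lemma haar2_box_at:
  "haar2 (box_at k l x) y =
     (if y \<in> box_points (box_at k l x)
      then if even \<lfloor>2 ^ Suc k * fst y\<rfloor> = even \<lfloor>2 ^ Suc l * snd y\<rfloor> then 1 else - 1
      else 0)"
  unfolding mem_box_at_iff by (auto simp: haar2_def box_at_def haar_dyadic_cell simp del: power_Suc)

lemma haar2_eq_0:
  assumes "R \<in> dyadic_boxes" "x \<notin> box_points R"
  shows "haar2 R x = 0"
proof -
  obtain y where "y \<in> box_points R"
    using assms(1) dyadic_box_nonempty by blast
  then obtain k l where "R = box_at k l y"
    using assms(1) dyadic_box_eq_some_box_at by blast
  then show ?thesis
    using assms(2) by (simp add: haar2_box_at)
qed

section \<open>Evaluating the Haar sum at a point\<close>

lemma haar_sum_outside: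
  assumes "x \<notin> {0..<1} \<times> {0..<1}"
  shows "haar_sum n \<epsilon> x = 0"
  unfolding haar_sum_def
proof (intro sum.neutral ballI)
  fix R assume "R \<in> {R \<in> dyadic_boxes. box_area R = 1 / 2 ^ n}"
  then have R: "R \<in> dyadic_boxes" "box_area R = 1 / 2 ^ n" by auto
  then have "x \<notin> box_points R"
    using dyadic_box_eq_box_at assms by blast
  with R(1) show "\<epsilon> R * haar2 R x = 0"
    by (simp add: haar2_eq_0)
qed

lemma haar_sum_eq:
  assumes "x \<in> {0..<1} \<times> {0..<1}"
  shows "haar_sum n \<epsilon> x = (\<Sum>k\<le>n. \<epsilon> (box_at k (n - k) x) * haar2 (box_at k (n - k) x) x)"
proof -
  let ?B = "\<lambda>k. box_at k (n - k) x"
  have inj: "inj_on ?B {..n}"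
  proof (rule inj_onI)
    fix k l assume "?B k = ?B l"
    \<comment> \<open>The width \<open>1 / 2 ^ k\<close> of the box determines
      \<open>k\<close>.\<close>
    then have "measure lborel (fst (?B k)) = measure lborel (fst (?B l))" by simp
    then show "k = l" by (simp add: box_at_def)
  qed
  have "haar_sum n \<epsilon> x = (\<Sum>R\<in>?B ` {..n}. \<epsilon> R * haar2 R x)"
    unfolding haar_sum_def
  proof (rule sum.mono_neutral_right[OF finite_dyadic_boxes_area])
    show "?B ` {..n} \<subseteq> {R \<in> dyadic_boxes. box_area R = 1 / 2 ^ n}"
      using box_at_in_dyadic_boxes[OF assms] by auto
    show "\<forall>R\<in>{R \<in> dyadic_boxes. box_area R = 1 / 2 ^ n} - ?B ` {..n}. \<epsilon> R * haar2 R x = 0"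
    proof
      fix R assume "R \<in> {R \<in> dyadic_boxes. box_area R = 1 / 2 ^ n} - ?B ` {..n}"
      then have R: "R \<in> dyadic_boxes" "box_area R = 1 / 2 ^ n" "R \<notin> ?B ` {..n}" by auto
      then have "x \<notin> box_points R"
        using dyadic_box_eq_box_at by blast
      with R(1) show "\<epsilon> R * haar2 R x = 0"
        by (simp add: haar2_eq_0)
    qed
  qed
  also have "\<dots> = (\<Sum>k\<le>n. \<epsilon> (?B k) * haar2 (?B k) x)"
    by (simp add: sum.reindex[OF inj])
  finally show ?thesis .
qed

section \<open>Squares attached to grid points\<close>

lemma mem_singleton_plus_iff: "x \<in> {p} + S \<longleftrightarrow> x - p \<in> S" for x :: "'a :: ab_group_add"
  unfolding set_plus_def by (auto intro: bexI[of _ "x - p"])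

text \<open>For a grid point the floors are exact, so the cells around its coordinates start at the
  coordinates themselves.\<close>

lemma singleton_plus_square:
  assumes "fst p = real i / 2 ^ N" "snd p = real j / 2 ^ N"
  shows "{p} + {0 ..< 1 / 2 ^ N} \<times> {0 ..< 1 / 2 ^ N} = box_points (box_at N N p)"
proof -
  have "2 ^ N * fst p = of_int (int i)" "2 ^ N * snd p = of_int (int j)"
    using assms by simp_all
  then have "\<lfloor>2 ^ N * fst p\<rfloor> = int i" "\<lfloor>2 ^ N * snd p\<rfloor> = int j"
    by (metis floor_of_int)+
  then have "x \<in> box_points (box_at N N p) \<longleftrightarrow>
      x - p \<in> {0 ..< 1 / 2 ^ N} \<times> {0 ..< 1 / 2 ^ N}" for x
    using assms by (auto simp: mem_box_at_iff dyadic_cell_def mem_Times_iff add_divide_distrib)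
  then show ?thesis
    by (auto simp only: mem_singleton_plus_iff)
qed

text \<open>The corner is recovered as the coordinatewise least point of its square.\<close>

lemma inj_singleton_plus_square:
  assumes "0 < (d :: real)"
  shows "inj (\<lambda>p. {p} + {0 ..< d} \<times> {0 ..< d})"
proof (rule injI)
  fix p q :: "real \<times> real"
  let ?S = "{0 ..< d} \<times> {0 ..< d}"
  have self: "r \<in> {r} + ?S" for r
    using assms by (simp add: mem_singleton_plus_iff mem_Times_iff)
  have ge: "fst s \<le> fst r \<and> snd s \<le> snd r" if "r \<in> {s} + ?S" for r s
    using that by (simp add: mem_singleton_plus_iff mem_Times_iff)
  assume "{p} + ?S = {q} + ?S"
  then have "p \<in> {q} + ?S" "q \<in> {p} + ?S"
    using self by blast+
  then show "p = q"
    using ge by (simp add: prod_eq_iff order_antisym)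
qed

section \<open>Signs read off the net points\<close>

definition net_sign :: "(real \<times> real) set \<Rightarrow> real set \<times> real set \<Rightarrow> real" where
  "net_sign P R = haar2 R (SOME p. p \<in> P \<and> p \<in> box_points R)"

context
  fixes n :: nat and P :: "(real \<times> real) set"
  assumes net: "binary_net (n + 1) P"
begin

lemma net_subset: "P \<subseteq> {0..<1} \<times> {0..<1}"
  using net by (simp add: binary_net_def)

lemma net_point:
  assumes "x \<in> {0..<1} \<times> {0..<1}" "k + l = Suc n"
  shows "\<exists>!p. p \<in> P \<and> p \<in> box_points (box_at k l x)"
  using net assms box_at_in_dyadic_boxes[OF assms(1), of k l]
  by (auto simp: binary_net_def)

lemma net_point_unique:
  assumes "x \<in> {0..<1} \<times> {0..<1}" "k + l = Suc n"
    and "p \<in> P" "p \<in> box_points (box_at k l x)" "q \<in> P" "q \<in> box_points (box_at k l x)"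
  shows "p = q"
  using net_point[OF assms(1,2)] assms(3-) by blast

lemma haar2_net_points_eq:
  assumes x: "x \<in> {0..<1} \<times> {0..<1}" and kl: "k + l = n"
    and p: "p \<in> P" "p \<in> box_points (box_at k l x)"
    and q: "q \<in> P" "q \<in> box_points (box_at k l x)"
  shows "haar2 (box_at k l x) p = haar2 (box_at k l x) q"
proof -
  have p01: "p \<in> {0..<1} \<times> {0..<1}"
    using p net_subset by blast
  have qp: "q \<in> box_points (box_at k l p)"
    using q box_at_eq[OF p(2)] by simp
  have "p = q" if "even \<lfloor>2 ^ Suc k * fst p\<rfloor> = even \<lfloor>2 ^ Suc k * fst q\<rfloor>"
    using net_point_unique[OF p01, of "Suc k" l p q] kl p(1) q(1) qp that
    by (simp add: mem_box_at_iff dyadic_cell_Suc del: power_Suc)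
  moreover have "p = q" if "even \<lfloor>2 ^ Suc l * snd p\<rfloor> = even \<lfloor>2 ^ Suc l * snd q\<rfloor>"
    using net_point_unique[OF p01, of k "Suc l" p q] kl p(1) q(1) qp that
    by (simp add: mem_box_at_iff dyadic_cell_Suc del: power_Suc)
  \<comment> \<open>Distinct points differ in both digits; flipping both preserves whether they
    agree, hence the Haar sign.\<close>
  ultimately have "p = q \<or>
      (even \<lfloor>2 ^ Suc k * fst p\<rfloor> \<noteq> even \<lfloor>2 ^ Suc k * fst q\<rfloor> \<and>
       even \<lfloor>2 ^ Suc l * snd p\<rfloor> \<noteq> even \<lfloor>2 ^ Suc l * snd q\<rfloor>)"
    by blast
  then show ?thesis
    using p(2) q(2) by (auto simp add: haar2_box_at simp del: power_Suc)
qed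

text \<open>The choice made by \<open>SOME\<close> is immaterial, since all net points of the box
  give the same Haar sign.\<close>

lemma net_sign_eq:
  assumes "x \<in> {0..<1} \<times> {0..<1}" "k + l = n" "p \<in> P" "p \<in> box_points (box_at k l x)"
  shows "net_sign P (box_at k l x) = haar2 (box_at k l x) p"
proof -
  have "\<exists>p. p \<in> P \<and> p \<in> box_points (box_at k l x)"
    using assms by blast
  from someI_ex[OF this] show ?thesis
    unfolding net_sign_def using haar2_net_points_eq[OF assms(1,2)] assms(3,4) by blast
qed

lemma net_sign_box_at:
  assumes "x \<in> {0..<1} \<times> {0..<1}" "k + l = n"
  shows "net_sign P (box_at k l x) \<in> {- 1, 1}"
proof -
  \<comment> \<open>The net property speaks of area \<open>1 / 2 ^ (n + 1)\<close>, so a point is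
    taken from the half of the box around \<open>x\<close>.\<close>
  obtain p where "p \<in> P" "p \<in> box_points (box_at (Suc k) l x)"
    using net_point[of x "Suc k" l] assms by auto
  moreover from this have "p \<in> box_points (box_at k l x)"
    by (simp add: mem_box_at_iff dyadic_cell_Suc)
  ultimately show ?thesis
    using net_sign_eq[OF assms] by (simp add: haar2_box_at)
qed

lemma net_sign_haar2_le:
  assumes "x \<in> {0..<1} \<times> {0..<1}" "k + l = n"
  shows "net_sign P (box_at k l x) * haar2 (box_at k l x) x \<le> 1"
  using net_sign_box_at[OF assms] by (auto simp: haar2_box_at)

lemma net_sign_pm1:
  assumes "R \<in> dyadic_boxes" "box_area R = 1 / 2 ^ n"
  shows "net_sign P R \<in> {- 1, 1}"
proof -
  obtain x where "x \<in> box_points R"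
    using assms(1) dyadic_box_nonempty by blast
  from dyadic_box_eq_box_at[OF assms this] obtain k
    where "x \<in> {0..<1} \<times> {0..<1}" "k \<le> n" and R: "R = box_at k (n - k) x"
    by blast
  then show ?thesis
    unfolding R by (intro net_sign_box_at) auto
qed

section \<open>The maximal value and where it is attained\<close>

lemma haar_sum_net_sign_le: "haar_sum n (net_sign P) x \<le> real n + 1"
proof (cases "x \<in> {0..<1} \<times> {0..<1}")
  case True
  have "haar_sum n (net_sign P) x \<le> (\<Sum>k\<le>n. 1)"
    unfolding haar_sum_eq[OF True] using net_sign_haar2_le[OF True] by (intro sum_mono) simp
  then show ?thesis by simp
qed (simp add: haar_sum_outside)

lemma haar_sum_near_net:
  assumes p: "p \<in> P" and "x \<in> box_points (box_at (Suc n) (Suc n) p)"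
  shows "haar_sum n (net_sign P) x = real n + 1"
proof -
  have p01: "p \<in> {0..<1} \<times> {0..<1}"
    using p net_subset by blast
  have near: "x \<in> box_points (box_at k l p)" if "k \<le> Suc n" "l \<le> Suc n" for k l
    using assms(2) that dyadic_cell_antimono by (auto simp: mem_box_at_iff)
  have x01: "x \<in> {0..<1} \<times> {0..<1}"
    using dyadic_box_eq_box_at[OF box_at_in_dyadic_boxes[OF p01] box_area_box_at assms(2)] ..
  have "net_sign P (box_at k (n - k) x) * haar2 (box_at k (n - k) x) x = 1" if "k \<le> n" for k
  proof -
    have B: "box_at k (n - k) x = box_at k (n - k) p"
      using that by (intro box_at_eq near) auto
    \<comment> \<open>One level finer in both coordinates: \<open>x\<close> and \<open>p\<close>
      share a quarter of the box, so the term is the square of a sign.\<close>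
    have "x \<in> box_points (box_at (Suc k) (Suc (n - k)) p)"
      using that by (intro near) auto
    then have "haar2 (box_at k (n - k) p) x = haar2 (box_at k (n - k) p) p"
      by (simp add: haar2_box_at mem_box_at_iff dyadic_cell_Suc del: power_Suc)
    moreover have "net_sign P (box_at k (n - k) p) = haar2 (box_at k (n - k) p) p"
      using that p by (intro net_sign_eq p01) auto
    ultimately show ?thesis
      unfolding B by (simp add: haar2_box_at del: power_Suc)
  qed
  then show ?thesis
    by (simp add: haar_sum_eq[OF x01])
qed

lemma haar_sum_max_imp_near_net:
  assumes max: "haar_sum n (net_sign P) x = real n + 1"
  shows "\<exists>p\<in>P. x \<in> box_points (box_at (Suc n) (Suc n) p)"
proof -
  have x: "x \<in> {0..<1} \<times> {0..<1}"
    using max haar_sum_outside[of x n "net_sign P"] by (cases "x \<in> {0..<1} \<times> {0..<1}") auto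
  let ?f = "\<lambda>k. net_sign P (box_at k (n - k) x) * haar2 (box_at k (n - k) x) x"
  \<comment> \<open>There are \<open>n + 1\<close> terms, each at most 1, with total
    \<open>n + 1\<close>.\<close>
  have f: "?f k = 1" if "k \<le> n" for k
  proof -
    have "(\<Sum>k\<le>n. 1 - ?f k) = 0"
      using max by (simp add: haar_sum_eq[OF x] sum_subtractf)
    moreover have "0 \<le> 1 - ?f k" if "k \<in> {..n}" for k
      using net_sign_haar2_le[OF x, of k "n - k"] that by simp
    ultimately have "\<forall>k\<in>{..n}. 1 - ?f k = 0"
      by (subst (asm) sum_nonneg_eq_0_iff) auto
    then show ?thesis using that by auto
  qed
  obtain p where p: "p \<in> P" and p0: "p \<in> box_points (box_at 0 (Suc n) x)"
    using net_point[OF x, of 0 "Suc n"] by auto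
  \<comment> \<open>The same \<open>p\<close> is followed while the box around \<open>x\<close> is
    halved in width and doubled in height.\<close>
  have "p \<in> box_points (box_at k (Suc n - k) x)" if "k \<le> Suc n" for k
    using that
  proof (induction k)
    case 0
    then show ?case using p0 by simp
  next
    case (Suc k)
    then have k: "k \<le> n" and IH: "p \<in> box_points (box_at k (Suc (n - k)) x)"
      by (simp_all add: Suc_diff_le)
    then have pR: "p \<in> box_points (box_at k (n - k) x)"
      and vert: "even \<lfloor>2 ^ Suc (n - k) * snd p\<rfloor> = even \<lfloor>2 ^ Suc (n - k) * snd x\<rfloor>"
      by (simp_all add: mem_box_at_iff dyadic_cell_Suc del: power_Suc)
    \<comment> \<open>The term at \<open>x\<close> is 1, so the Haar signs at \<open>p\<close> and
      \<open>x\<close> agree; equal vertical digits then force equal horizontal ones.\<close>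
    have "haar2 (box_at k (n - k) x) p * haar2 (box_at k (n - k) x) x = 1"
      using f[OF k] net_sign_eq[OF x _ p pR] k by simp
    then have "even \<lfloor>2 ^ Suc k * fst p\<rfloor> = even \<lfloor>2 ^ Suc k * fst x\<rfloor>"
      using pR vert by (auto simp: haar2_box_at simp del: power_Suc split: if_splits)
    then show ?case
      using pR by (simp add: mem_box_at_iff dyadic_cell_Suc del: power_Suc)
  qed
  \<comment> \<open>\<open>k = 0\<close> locates the second coordinate at level
    \<open>Suc n\<close>, and \<open>k = Suc n\<close> the first.\<close>
  from this[of 0] this[of "Suc n"] have "p \<in> box_points (box_at (Suc n) (Suc n) x)"
    by (simp add: mem_box_at_iff)
  then have "x \<in> box_points (box_at (Suc n) (Suc n) p)"
    using box_at_eq mem_box_at_self by metis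
  then show ?thesis using p by blast
qed

end

theorem proposition8:
  fixes n :: nat and P :: "(real \<times> real) set"
  assumes "binary_net (n + 1) P"
    and "\<forall>p\<in>P. (\<exists>j<2 ^ (n + 1). fst p = real j / 2 ^ (n + 1)) \<and>
               (\<exists>k<2 ^ (n + 1). snd p = real k / 2 ^ (n + 1))"
  shows "\<exists>\<epsilon> :: real set \<times> real set \<Rightarrow> real.
           (\<forall>R\<in>dyadic_boxes. box_area R = 1 / 2 ^ n \<longrightarrow> \<epsilon> R \<in> {-1, 1}) \<and>
           (\<forall>x. haar_sum n \<epsilon> x \<le> real n + 1) \<and>
           {x. haar_sum n \<epsilon> x = real n + 1}
             = P + {0 ..< 1 / 2 ^ (n + 1)} \<times> {0 ..< 1 / 2 ^ (n + 1)} \<and>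
           (\<lambda>p. {p} + {0 ..< 1 / 2 ^ (n + 1)} \<times> {0 ..< 1 / 2 ^ (n + 1)}) ` P
             \<subseteq> dyadic_squares (n + 1) \<and>
           card ((\<lambda>p. {p} + {0 ..< 1 / 2 ^ (n + 1)} \<times> {0 ..< 1 / 2 ^ (n + 1)}) ` P)
             = 2 ^ (n + 1)"
proof -
  let ?S = "{0 ..< 1 / 2 ^ (n + 1)} \<times> {0 ..< 1 / 2 ^ (n + 1)} :: (real \<times> real) set"
  note net = assms(1)
  \<comment> \<open>The grid form of the net points enters here.\<close>
  have sq: "{p} + ?S = box_points (box_at (n + 1) (n + 1) p)" if "p \<in> P" for p
    using assms(2) that singleton_plus_square by blast
  have "P + ?S = (\<Union>p\<in>P. {p} + ?S)"
    by (auto simp: set_plus_def)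
  also have "\<dots> = (\<Union>p\<in>P. box_points (box_at (Suc n) (Suc n) p))"
    using sq by simp
  also have "\<dots> = {x. haar_sum n (net_sign P) x = real n + 1}"
    using haar_sum_near_net[OF net] haar_sum_max_imp_near_net[OF net] by blast
  finally have "{x. haar_sum n (net_sign P) x = real n + 1} = P + ?S" ..
  moreover have "(\<lambda>p. {p} + ?S) ` P \<subseteq> dyadic_squares (n + 1)"
  proof (rule image_subsetI)
    fix p assume p: "p \<in> P"
    then have "fst p \<in> {0..<1}" "snd p \<in> {0..<1}"
      using net_subset[OF net] by auto
    then show "{p} + ?S \<in> dyadic_squares (n + 1)"
      unfolding sq[OF p] dyadic_squares_def box_at_def
      using dyadic_cell_in_dyadic_intervals measure_dyadic_cell by blast
  qed
  \<comment> \<open>Distinct net points give distinct squares, so the squares are counted by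
    \<open>card P\<close>.\<close>
  moreover have "inj_on (\<lambda>p. {p} + ?S) P"
    by (rule inj_on_subset[OF inj_singleton_plus_square]) simp_all
  then have "card ((\<lambda>p. {p} + ?S) ` P) = 2 ^ (n + 1)"
    using net by (simp add: card_image binary_net_def)
  ultimately show ?thesis
    using net_sign_pm1[OF net] haar_sum_net_sign_le[OF net] by blast
qed

end
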